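(* Let $L\in\mathbb{N}$ and $W(\theta)=\sum_{\ell=1}^La_\ell\cos\ell\theta$, $\theta\in[0,2\pi)$, where $a_1>a_2>\dots>a_L>0$. Then for $\kappa>2/a_L$ there exists a global 'Kuramoto'-type branch of non-trivial solutions of the stationary McKean-Vlasov equation $\partial_{\theta\theta}p=\kappa\,\partial_\theta(p\,\partial_\theta(W\star p))$ given by $$\pi_\kappa(\theta):=\frac{1}{I_0(\kappa a_Lr_\kappa)}\exp\big(\kappa a_Lr_\kappa\cos L\theta\big),\quad\theta\in[0,2\pi),$$ where $r_\kappa$ is the unique positive solution of $$r_\kappa=\frac{I_1(\kappa a_Lr_\kappa)}{I_0(\kappa a_Lr_\kappa)}.$$
   Context: $\mathbb{S}^1=[0,2\pi)$; $(W\star p)(\theta)=\frac1{2\pi}\int_0^{2\pi}W(\theta-\phi)p(\phi)\,d\phi$; solutions are probability densities with respect to $d\theta/2\pi$, i.e. $p\ge0$ and $\frac1{2\pi}\int_0^{2\pi}p\,d\theta=1$; non-trivial means different from the uniform density $p\equiv1$. $I_\ell(x)=\frac1{2\pi}\int_0^{2\pi}e^{x\cos\phi}\cos(\ell\phi)\,d\phi$ is the modified Bessel function of the first kind. *)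

theory Defs
  imports "HOL-Analysis.Analysis"
begin

text \<open>
  Functions on the circle are represented by their \<open>2\<pi>\<close>-periodic extensions to the real line, so
  that derivatives on the real line are derivatives on the circle, also at the point \<open>0\<close>.
\<close>

definition circle_function :: "(real \<Rightarrow> real) \<Rightarrow> bool" where
  "circle_function f \<longleftrightarrow> (\<forall>x. f (x + 2 * pi) = f x)"

definition circle_conv :: "(real \<Rightarrow> real) \<Rightarrow> (real \<Rightarrow> real) \<Rightarrow> real \<Rightarrow> real" where
  "circle_conv W p x = 1 / (2 * pi) * integral {0..2 * pi} (\<lambda>y. W (x - y) * p y)"

definition bessel_I :: "nat \<Rightarrow> real \<Rightarrow> real" where
  "bessel_I l x = 1 / (2 * pi) * integral {0..2 * pi} (\<lambda>t. exp (x * cos t) * cos (real l * t))"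

text \<open>Probability densities with respect to \<open>d\<theta>/2\<pi>\<close>.\<close>

definition circle_density :: "(real \<Rightarrow> real) \<Rightarrow> bool" where
  "circle_density p \<longleftrightarrow>
     circle_function p \<and> (\<forall>x. p x \<ge> 0) \<and> p integrable_on {0..2 * pi} \<and>
     1 / (2 * pi) * integral {0..2 * pi} p = 1"

text \<open>
  Classical solutions of \<open>p'' = \<kappa> (p (W \<star> p)')'\<close> that are probability densities. The
  differentiability conditions make every \<^const>\<open>deriv\<close> in the equation a genuine derivative.
\<close>

definition stationary_McKean_Vlasov :: "(real \<Rightarrow> real) \<Rightarrow> real \<Rightarrow> (real \<Rightarrow> real) \<Rightarrow> bool" where
  "stationary_McKean_Vlasov W \<kappa> p \<longleftrightarrow>
     circle_density p \<and>
     (\<forall>x. p differentiable at x) \<and>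
     (\<forall>x. deriv p differentiable at x) \<and>
     (\<forall>x. circle_conv W p differentiable at x) \<and>
     (\<forall>x. (\<lambda>y. p y * deriv (circle_conv W p) y) differentiable at x) \<and>
     (\<forall>x. deriv (deriv p) x = \<kappa> * deriv (\<lambda>y. p y * deriv (circle_conv W p) y) x)"

text \<open>
  A branch is a curve \<open>\<kappa> \<mapsto> p \<kappa>\<close> of solutions that is continuous in the supremum norm;
  it is global in that it is defined for all \<open>\<kappa> > \<kappa>\<^sub>0\<close>. Non-trivial means different
  from the uniform density \<open>1\<close>.
\<close>

definition global_nontrivial_branch ::
    "(real \<Rightarrow> real) \<Rightarrow> real \<Rightarrow> (real \<Rightarrow> real \<Rightarrow> real) \<Rightarrow> bool" where
  "global_nontrivial_branch W \<kappa>\<^sub>0 p \<longleftrightarrow>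
     (\<forall>\<kappa>>\<kappa>\<^sub>0. stationary_McKean_Vlasov W \<kappa> (p \<kappa>) \<and> p \<kappa> \<noteq> (\<lambda>_. 1)) \<and>
     (\<forall>\<kappa>>\<kappa>\<^sub>0. uniform_limit UNIV p (p \<kappa>) (at \<kappa>))"

end

theory Submission imports Defs begin

text \<open>
  Write \<open>p\<^sub>z\<close> for the density proportional to \<open>exp (z cos (L x))\<close>. It has period \<open>2\<pi> / L\<close>, so
  among the modes of \<open>W\<close> only the \<open>L\<close>-th one survives the convolution (\<open>fourier_coeffs_vanish\<close>), and
  \<open>W \<star> p\<^sub>z = a\<^sub>L (I\<^sub>1(z) / I\<^sub>0(z)) cos (L x)\<close> (\<open>circle_conv_kuramoto\<close>). Since
  \<open>p\<^sub>z' = p\<^sub>z (z cos (L x))'\<close>, the flux \<open>p' - \<kappa> p (W \<star> p)'\<close> vanishes identically as soon as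
  \<open>z = \<kappa> a\<^sub>L I\<^sub>1(z) / I\<^sub>0(z)\<close> (\<open>stationary_kuramoto_density\<close>). With \<open>z = \<kappa> a\<^sub>L r\<close> this is the
  self-consistency equation for \<open>r\<close>.

  To solve that equation, integrate by parts: \<open>I\<^sub>1(z) / I\<^sub>0(z) = z S(z)\<close>, where \<open>S(z)\<close> is the mean of
  \<open>sin\<^sup>2\<close> under the density proportional to \<open>exp (z cos t)\<close>. For \<open>z > 0\<close> the equation becomes
  \<open>S(z) = 1 / (\<kappa> a\<^sub>L)\<close>. The function \<open>S\<close> is continuous, equals \<open>1/2\<close> at \<open>0\<close>, is at most
  \<open>1/z\<close>, and is strictly decreasing on the half line (\<open>sin_squared_mean_strict_antimono\<close>), so there
  is exactly one positive solution when \<open>\<kappa> a\<^sub>L > 2\<close>. As the inverse of a strictly monotone continuous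
  function it depends continuously on \<open>\<kappa>\<close> (\<open>isCont_branch_parameter\<close>), and
  compactness turns this into continuity of the branch in the supremum norm
  (\<open>uniform_limit_kuramoto_density\<close>).
\<close>

section \<open>Integrals of periodic functions over a period\<close>

lemma continuous_integrable_Icc:
  fixes f :: "real \<Rightarrow> real"
  assumes "continuous_on UNIV f"
  shows "f integrable_on {a..b}"
  using assms integrable_continuous_real continuous_on_subset by blast

lemma integral_shift:
  fixes f :: "real \<Rightarrow> real"
  shows "integral {a..b} (\<lambda>x. f (x + c)) = integral {a+c..b+c} f"
  using integral_shift_Icc_real[of a b f c] by (simp add: o_def add.commute)

lemma periodic_integral_shift:
  fixes f :: "real \<Rightarrow> real"
  assumes cont: "continuous_on UNIV f" and per: "\<And>x. f (x + T) = f x"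
    and c: "0 \<le> c" "c \<le> T"
  shows "integral {0..T} (\<lambda>x. f (x + c)) = integral {0..T} f"
proof -
  have "integral {0..T} (\<lambda>x. f (x + c)) = integral {c..T + c} f"
    using integral_shift[of 0 T f c] by simp
  also have "\<dots> = integral {c..T} f + integral {T..T + c} f"
    using c by (intro Henstock_Kurzweil_Integration.integral_combine[symmetric]
        continuous_integrable_Icc cont) auto
  also have "integral {T..T + c} f = integral {0..c} f"
    using integral_shift[of 0 c f T] by (simp add: per add.commute)
  also have "integral {c..T} f + integral {0..c} f = integral {0..T} f"
    using c by (subst add.commute, intro Henstock_Kurzweil_Integration.integral_combine
        continuous_integrable_Icc cont) auto
  finally show ?thesis .
qed

lemma periodic_integral_reflect:
  fixes f :: "real \<Rightarrow> real"
  assumes "\<And>x. f (x + T) = f x"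
  shows "integral {0..T} (\<lambda>x. f (- x)) = integral {0..T} f"
proof -
  have "integral {0..T} (\<lambda>x. f (- x)) = integral {-T..0} f"
    using Henstock_Kurzweil_Integration.integral_reflect_real[of 0 "-T" f] by simp
  also have "\<dots> = integral {0..T} f"
    using integral_shift[of "-T" 0 f T] by (simp add: assms)
  finally show ?thesis .
qed

lemma periodic_multiple:
  fixes f :: "real \<Rightarrow> 'a"
  assumes "\<And>x. f (x + T) = f x"
  shows "f (x + real n * T) = f x"
proof (induction n)
  case (Suc n)
  have "f (x + real (Suc n) * T) = f ((x + real n * T) + T)"
    by (simp add: algebra_simps)
  with Suc show ?case by (simp add: assms)
qed simp

text \<open>
  The interval of integration is stretched to \<open>n\<close> periods, and the factor \<open>1 / n\<close> from the
  substitution cancels their number.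
\<close>

lemma periodic_integral_stretch:
  fixes f :: "real \<Rightarrow> real"
  assumes cont: "continuous_on UNIV f" and per: "\<And>x. f (x + T) = f x"
    and "n \<ge> 1" "T \<ge> 0"
  shows "integral {0..T} (\<lambda>x. f (real n * x)) = integral {0..T} f"
proof -
  have periods: "integral {0..real m * T} f = real m * integral {0..T} f" for m
  proof (induction m)
    case (Suc m)
    have "integral {0..real (Suc m) * T} f
        = integral {0..real m * T} f + integral {real m * T..real (Suc m) * T} f"
      using \<open>T \<ge> 0\<close>
      by (intro Henstock_Kurzweil_Integration.integral_combine[symmetric]
          continuous_integrable_Icc cont) (auto simp: algebra_simps)
    also have "integral {real m * T..real (Suc m) * T} f = integral {0..T} f"
      using integral_shift[of 0 T f "real m * T"] periodic_multiple[of f T, OF per]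
      by (simp add: algebra_simps)
    finally show ?case using Suc by (simp add: algebra_simps)
  qed simp
  have "(\<lambda>x. x / real n) ` {0..real n * T} = {0..T}"
    using \<open>n \<ge> 1\<close> by (simp add: image_divide_atLeastAtMost)
  then have "integral {0..T} (\<lambda>x. f (real n * x)) = (1 / real n) * integral {0..real n * T} f"
    using integral_stretch_real[of "real n" 0 "real n * T" f] \<open>n \<ge> 1\<close> by simp
  then show ?thesis using \<open>n \<ge> 1\<close> by (simp add: periods)
qed

lemma integral_pos_of_continuous:
  fixes f :: "real \<Rightarrow> real"
  assumes "continuous_on {a..b} f" "a < b" "\<And>x. x \<in> {a..b} \<Longrightarrow> f x \<ge> 0"
    and "t \<in> {a..b}" "f t > 0"
  shows "integral {a..b} f > 0"
proof -
  have "integral {a..b} f \<noteq> 0"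
    using integral_eq_0_iff[OF assms(1-3)] assms(4,5) by force
  moreover have "integral {a..b} f \<ge> 0"
    using assms by (intro Henstock_Kurzweil_Integration.integral_nonneg
        integrable_continuous_real) auto
  ultimately show ?thesis by simp
qed

section \<open>The ratio of the first two Bessel functions\<close>

abbreviation circle_integral :: "(real \<Rightarrow> real) \<Rightarrow> real" where
  "circle_integral f \<equiv> integral {0..2 * pi} f"

text \<open>
  The mean of \<open>sin\<^sup>2\<close> under the von Mises density, the one proportional to \<open>exp (x cos t)\<close>. It plays
  the role of \<open>I\<^sub>1(x) / (x I\<^sub>0(x))\<close>, but is also well defined at \<open>x = 0\<close>.
\<close>

definition sin_squared_mean :: "real \<Rightarrow> real" where
  "sin_squared_mean x = circle_integral (\<lambda>t. (sin t)\<^sup>2 * exp (x * cos t)) / circle_integral (\<lambda>t. exp (x * cos t))"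

lemma bessel_I0_eq: "bessel_I 0 x = circle_integral (\<lambda>t. exp (x * cos t)) / (2 * pi)"
  by (simp add: bessel_I_def)

lemma circle_integral_exp_cos_pos: "circle_integral (\<lambda>t. exp (x * cos t)) > 0"
  by (rule integral_pos_of_continuous[where t = 0]) (auto intro!: continuous_intros)

lemma bessel_I0_pos: "bessel_I 0 x > 0"
  using circle_integral_exp_cos_pos by (simp add: bessel_I0_eq)

text \<open>
  Integration by parts: the difference of the two integrands is the derivative of the periodic
  function \<open>sin t exp (x cos t)\<close>.
\<close>

lemma circle_integral_cos_exp_cos:
  "circle_integral (\<lambda>t. cos t * exp (x * cos t)) = x * circle_integral (\<lambda>t. (sin t)\<^sup>2 * exp (x * cos t))"
proof -
  have "((\<lambda>t. cos t * exp (x * cos t) - x * ((sin t)\<^sup>2 * exp (x * cos t)))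
      has_integral (sin (2 * pi) * exp (x * cos (2 * pi)) - sin 0 * exp (x * cos 0))) {0..2 * pi}"
    by (rule fundamental_theorem_of_calculus)
      (auto intro!: derivative_eq_intros
        simp: has_real_derivative_iff_has_vector_derivative[symmetric] power2_eq_square algebra_simps)
  then have "circle_integral (\<lambda>t. cos t * exp (x * cos t) - x * ((sin t)\<^sup>2 * exp (x * cos t))) = 0"
    by (simp add: integral_unique)
  moreover have "circle_integral (\<lambda>t. cos t * exp (x * cos t) - x * ((sin t)\<^sup>2 * exp (x * cos t)))
     = circle_integral (\<lambda>t. cos t * exp (x * cos t)) - circle_integral (\<lambda>t. x * ((sin t)\<^sup>2 * exp (x * cos t)))"
    by (intro Henstock_Kurzweil_Integration.integral_diff continuous_integrable_Icc)
      (auto intro!: continuous_intros)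
  ultimately show ?thesis by simp
qed

lemma bessel_ratio_eq: "bessel_I 1 x / bessel_I 0 x = x * sin_squared_mean x"
  using circle_integral_cos_exp_cos[of x]
  by (simp add: bessel_I_def sin_squared_mean_def mult.commute)

lemma sin_squared_mean_0: "sin_squared_mean 0 = 1 / 2"
proof -
  have "((\<lambda>t. (sin t)\<^sup>2) has_integral
      ((2 * pi - sin (2 * pi) * cos (2 * pi)) / 2 - (0 - sin 0 * cos 0) / 2)) {0..2 * pi}"
  proof (rule fundamental_theorem_of_calculus)
    fix t :: real
    have "(1 - (cos t * cos t - sin t * sin t)) / 2 = (sin t)\<^sup>2"
      using sin_cos_squared_add[of t] by (simp add: power2_eq_square)
    then show "((\<lambda>t. (t - sin t * cos t) / 2) has_vector_derivative (sin t)\<^sup>2)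
        (at t within {0..2 * pi})"
      by (auto intro!: derivative_eq_intros
        simp: has_real_derivative_iff_has_vector_derivative[symmetric])
  qed simp
  then show ?thesis by (simp add: sin_squared_mean_def integral_unique)
qed

text \<open>
  The bound expresses \<open>I\<^sub>1(x) \<le> I\<^sub>0(x)\<close>; it supplies the upper end point for the intermediate value
  theorem.
\<close>

lemma sin_squared_mean_le:
  assumes "x > 0"
  shows "sin_squared_mean x \<le> 1 / x"
proof -
  have "x * circle_integral (\<lambda>t. (sin t)\<^sup>2 * exp (x * cos t)) \<le> circle_integral (\<lambda>t. exp (x * cos t))"
    unfolding circle_integral_cos_exp_cos[symmetric]
    by (rule integral_le) (auto intro!: continuous_integrable_Icc continuous_intros)
  then show ?thesis
    using assms circle_integral_exp_cos_pos[of x] by (simp add: sin_squared_mean_def field_simps)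
qed

lemma continuous_on_circle_integral_exp_cos:
  assumes "continuous_on UNIV f"
  shows "continuous_on UNIV (\<lambda>x. circle_integral (\<lambda>t. f t * exp (x * cos t)))"
proof -
  have "continuous_on (UNIV \<times> cbox 0 (2 * pi)) (\<lambda>(x::real, t). f t * exp (x * cos t))"
    unfolding case_prod_unfold
    by (intro continuous_intros continuous_on_compose2[OF assms]) auto
  from integral_continuous_on_param[OF this] show ?thesis by simp
qed

lemma continuous_sin_squared_mean: "continuous_on UNIV sin_squared_mean"
proof -
  have "continuous_on UNIV (\<lambda>x. circle_integral (\<lambda>t. exp (x * cos t)))"
    using continuous_on_circle_integral_exp_cos[of "\<lambda>_. 1"] by simp
  moreover have "continuous_on UNIV (\<lambda>x. circle_integral (\<lambda>t. (sin t)\<^sup>2 * exp (x * cos t)))"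
    by (rule continuous_on_circle_integral_exp_cos) (auto intro!: continuous_intros)
  moreover have "circle_integral (\<lambda>t. exp (x * cos t)) \<noteq> 0" for x
    using circle_integral_exp_cos_pos[of x] by simp
  ultimately show ?thesis
    unfolding sin_squared_mean_def[abs_def] by (intro continuous_on_divide) auto
qed

lemma continuous_bessel_I0: "continuous_on UNIV (bessel_I 0)"
  using continuous_on_circle_integral_exp_cos[of "\<lambda>_. 1"]
  by (auto simp: bessel_I0_eq[abs_def] intro!: continuous_intros)

text \<open>
  The ratio \<open>cosh (y c) / cosh (x c)\<close> increases strictly with \<open>\<bar>c\<bar>\<close> when \<open>0 \<le> x < y\<close>. By the
  product formula for \<open>cosh\<close> it suffices to compare \<open>cosh\<close> at sums and at differences of the
  arguments, where \<open>cosh\<close> is a strictly increasing function of the absolute value.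
\<close>

lemma cosh_cross_less:
  fixes x y c d :: real
  assumes "0 \<le> x" "x < y" "\<bar>d\<bar> < \<bar>c\<bar>"
  shows "cosh (x * c) * cosh (y * d) < cosh (y * c) * cosh (x * d)"
proof -
  have prod: "2 * (cosh u * cosh v) = cosh (u + v) + cosh (u - v)" for u v :: real
    by (simp add: cosh_add cosh_diff)
  have less: "cosh u < cosh v" if "\<bar>u\<bar> < \<bar>v\<bar>" for u v :: real
    using that cosh_real_nonneg_less_iff[of "\<bar>u\<bar>" "\<bar>v\<bar>"] by simp
  define C D where "C = \<bar>c\<bar>" and "D = \<bar>d\<bar>"
  have CD: "0 \<le> D" "D < C" using assms by (auto simp: C_def D_def)
  have a: "(y - x) * (C - D) > 0" "(y - x) * (C + D) > 0" "(y + x) * (C - D) > 0"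
    "x * C \<ge> 0" "y * C \<ge> 0" "x * D \<ge> 0" "y * D \<ge> 0"
    using assms CD by (auto intro!: mult_pos_pos)
  have "cosh (x * C + y * D) < cosh (y * C + x * D)"
    by (rule less) (use a in \<open>auto simp: algebra_simps\<close>)
  moreover have "cosh (x * C - y * D) < cosh (y * C - x * D)"
    by (rule less) (use a in \<open>auto simp: algebra_simps\<close>)
  ultimately have "cosh (x * C) * cosh (y * D) < cosh (y * C) * cosh (x * D)"
    using prod[of "x * C" "y * D"] prod[of "y * C" "x * D"] by linarith
  moreover have "cosh (u * \<bar>v\<bar>) = cosh (u * v)" for u v :: real
    by (cases "v \<ge> 0") auto
  ultimately show ?thesis by (simp add: C_def D_def)
qed

text \<open>
  The half turn \<open>t \<mapsto> t + \<pi>\<close> changes the sign of \<open>cos t\<close>, so that only the even part of the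
  exponential contributes.
\<close>

lemma circle_integral_even_exp_cos:
  assumes "continuous_on UNIV h" "\<And>u. h (- u) = h u"
  shows "circle_integral (\<lambda>t. h (cos t) * exp (x * cos t)) = circle_integral (\<lambda>t. h (cos t) * cosh (x * cos t))"
proof -
  have int: "(\<lambda>t. h (cos t) * g t) integrable_on {0..2 * pi}" if "continuous_on UNIV g" for g
    by (intro continuous_integrable_Icc continuous_intros that
        continuous_on_compose2[OF assms(1)]) auto
  let ?f = "\<lambda>t. h (cos t) * exp (x * cos t)"
  have "circle_integral ?f = circle_integral (\<lambda>t. ?f (t + pi))"
    by (rule periodic_integral_shift[symmetric])
      (auto intro!: continuous_intros continuous_on_compose2[OF assms(1)])
  then have "circle_integral ?f = circle_integral (\<lambda>t. h (cos t) * exp (- (x * cos t)))"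
    by (simp add: assms(2))
  moreover have "circle_integral (\<lambda>t. h (cos t) * exp (x * cos t) + h (cos t) * exp (- (x * cos t)))
     = circle_integral ?f + circle_integral (\<lambda>t. h (cos t) * exp (- (x * cos t)))"
    by (intro Henstock_Kurzweil_Integration.integral_add int continuous_intros)
  moreover have "h (cos t) * exp (x * cos t) + h (cos t) * exp (- (x * cos t))
      = 2 * (h (cos t) * cosh (x * cos t))" for t
    by (simp add: cosh_field_def algebra_simps)
  ultimately show ?thesis by simp
qed

text \<open>
  Equivalently, the mean of \<open>cos\<^sup>2\<close> increases strictly. This is an instance of Chebyshev's
  correlation inequality: after symmetrisation the weights are \<open>cosh (x cos t)\<close> and \<open>cosh (y cos t)\<close>,
  and both \<open>cos\<^sup>2 t\<close> and the quotient of the weights are increasing functions of \<open>\<bar>cos t\<bar>\<close>. Centring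
  at the point \<open>\<bar>cos t\<bar> = d\<close>, where \<open>cos\<^sup>2 t\<close> equals its mean \<open>m\<close> for the parameter \<open>x\<close>, avoids the
  double integral of the usual proof.
\<close>

lemma sin_squared_mean_strict_antimono:
  assumes "0 \<le> x" "x < y"
  shows "sin_squared_mean y < sin_squared_mean x"
proof -
  define Z where "Z w = circle_integral (\<lambda>t. exp (w * cos t))" for w
  define K where "K w = circle_integral (\<lambda>t. (cos t)\<^sup>2 * exp (w * cos t))" for w
  define m where "m = K x / Z x"
  define d where "d = sqrt m"
  have Zpos: "Z w > 0" for w unfolding Z_def by (rule circle_integral_exp_cos_pos)
  have S: "sin_squared_mean w = 1 - K w / Z w" for w
  proof -
    have "circle_integral (\<lambda>t. exp (w * cos t) - (cos t)\<^sup>2 * exp (w * cos t)) = Z w - K w"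
      unfolding Z_def K_def
      by (intro Henstock_Kurzweil_Integration.integral_diff continuous_integrable_Icc)
        (auto intro!: continuous_intros)
    moreover have "exp (w * cos t) - (cos t)\<^sup>2 * exp (w * cos t) = (sin t)\<^sup>2 * exp (w * cos t)" for t
      by (simp add: sin_squared_eq algebra_simps)
    ultimately have "circle_integral (\<lambda>t. (sin t)\<^sup>2 * exp (w * cos t)) = Z w - K w" by simp
    then show ?thesis
      using Zpos[of w] by (simp add: sin_squared_mean_def Z_def[symmetric] diff_divide_distrib)
  qed
  have "K x \<ge> 0"
    unfolding K_def by (intro Henstock_Kurzweil_Integration.integral_nonneg
        continuous_integrable_Icc) (auto intro!: continuous_intros)
  then have "m \<ge> 0" using Zpos[of x] by (simp add: m_def)
  then have d: "d\<^sup>2 = m" "d \<ge> 0" by (auto simp: d_def)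
  have mean: "circle_integral (\<lambda>t. ((cos t)\<^sup>2 - m) * cosh (w * cos t)) = K w - m * Z w" for w
  proof -
    have "circle_integral (\<lambda>t. ((cos t)\<^sup>2 - m) * cosh (w * cos t))
        = circle_integral (\<lambda>t. ((cos t)\<^sup>2 - m) * exp (w * cos t))"
      by (rule circle_integral_even_exp_cos[symmetric]) (auto intro!: continuous_intros)
    also have "\<dots> = circle_integral (\<lambda>t. (cos t)\<^sup>2 * exp (w * cos t) - m * exp (w * cos t))"
      by (simp add: algebra_simps)
    also have "\<dots> = K w - circle_integral (\<lambda>t. m * exp (w * cos t))"
      unfolding K_def
      by (intro Henstock_Kurzweil_Integration.integral_diff continuous_integrable_Icc)
        (auto intro!: continuous_intros)
    finally show ?thesis by (simp add: Z_def)
  qed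
  \<comment> \<open>Both factors change sign at \<open>\<bar>cos t\<bar> = d\<close>, in the same direction.\<close>
  define g where "g t = ((cos t)\<^sup>2 - m) *
      (cosh (y * cos t) * cosh (x * d) - cosh (x * cos t) * cosh (y * d))" for t
  have g: "g t > 0" if "(cos t)\<^sup>2 \<noteq> m" for t
  proof (cases "(cos t)\<^sup>2 > m")
    case True
    then have "\<bar>d\<bar> < \<bar>cos t\<bar>" using d abs_le_square_iff[of "cos t" d] by linarith
    from cosh_cross_less[OF assms this] True show ?thesis by (simp add: g_def)
  next
    case False
    then have "\<bar>cos t\<bar> < \<bar>d\<bar>" using d that abs_le_square_iff[of d "cos t"] by linarith
    from cosh_cross_less[OF assms this] False that show ?thesis
      by (simp add: g_def mult_neg_neg mult.commute)
  qed
  \<comment> \<open>As \<open>cos\<^sup>2\<close> takes the values \<open>0\<close> and \<open>1\<close>, it is not constantly \<open>m\<close>.\<close>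
  obtain t where t: "t \<in> {0..2 * pi}" "(cos t)\<^sup>2 \<noteq> m"
  proof (cases "m = 1")
    case True then show ?thesis using that[of "pi / 2"] by simp
  next
    case False then show ?thesis using that[of 0] by simp
  qed
  have "circle_integral g > 0"
  proof (rule integral_pos_of_continuous)
    show "continuous_on {0..2 * pi} g"
      unfolding g_def[abs_def] by (intro continuous_intros)
    show "g s \<ge> 0" for s
      using g[of s] by (cases "(cos s)\<^sup>2 = m") (auto simp: g_def)
  qed (use t g in auto)
  \<comment> \<open>The second factor of \<open>g\<close> splits the integral in two; the part with weight
    \<open>cosh (x cos t)\<close> vanishes by the choice of \<open>m\<close>.\<close>
  also have "circle_integral g = circle_integral (\<lambda>t. cosh (x * d) * (((cos t)\<^sup>2 - m) * cosh (y * cos t))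
        - cosh (y * d) * (((cos t)\<^sup>2 - m) * cosh (x * cos t)))"
    by (simp add: g_def[abs_def] algebra_simps)
  also have "\<dots> = circle_integral (\<lambda>t. cosh (x * d) * (((cos t)\<^sup>2 - m) * cosh (y * cos t)))
      - circle_integral (\<lambda>t. cosh (y * d) * (((cos t)\<^sup>2 - m) * cosh (x * cos t)))"
    by (intro Henstock_Kurzweil_Integration.integral_diff continuous_integrable_Icc)
        (auto intro!: continuous_intros)
  also have "\<dots> = cosh (x * d) * (K y - m * Z y) - cosh (y * d) * (K x - m * Z x)"
    by (simp add: mean)
  also have "K x - m * Z x = 0" using Zpos[of x] by (simp add: m_def)
  finally have "K y - m * Z y > 0"
    using cosh_real_pos[of "x * d"] by (simp add: zero_less_mult_iff del: cosh_real_pos)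
  then have "m < K y / Z y" using Zpos[of y] by (simp add: field_simps)
  then show ?thesis by (simp add: S m_def)
qed

section \<open>Solving the self-consistency equation\<close>

lemma sin_squared_mean_solution:
  assumes "0 < u" "u < 1 / 2"
  shows "\<exists>!x. x > 0 \<and> sin_squared_mean x = u"
proof (rule ex_ex1I)
  have "sin_squared_mean (1 / u) \<le> u" using sin_squared_mean_le[of "1 / u"] assms by simp
  moreover have "u \<le> sin_squared_mean 0" using assms by (simp add: sin_squared_mean_0)
  ultimately obtain x where "0 \<le> x" "sin_squared_mean x = u"
    using IVT2'[of sin_squared_mean "1 / u" u 0] assms
      continuous_on_subset[OF continuous_sin_squared_mean] by auto
  moreover have "x \<noteq> 0" using calculation assms by (auto simp: sin_squared_mean_0)
  ultimately show "\<exists>x. x > 0 \<and> sin_squared_mean x = u" by (intro exI[of _ x]) auto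
next
  fix x y assume "x > 0 \<and> sin_squared_mean x = u" "y > 0 \<and> sin_squared_mean y = u"
  then show "x = y"
    using sin_squared_mean_strict_antimono[of x y] sin_squared_mean_strict_antimono[of y x]
    by (cases x y rule: linorder_cases) auto
qed

text \<open>
  The parameter \<open>z = \<kappa> a\<^sub>L r\<close> of the branch at \<open>k = \<kappa> a\<^sub>L\<close>; the description denotes a unique number
  for \<open>k > 2\<close>.
\<close>

definition branch_parameter :: "real \<Rightarrow> real" where
  "branch_parameter k = (THE x. x > 0 \<and> sin_squared_mean x = 1 / k)"

lemma branch_parameter:
  assumes "k > 2"
  shows "branch_parameter k > 0" "sin_squared_mean (branch_parameter k) = 1 / k"
    and "x > 0 \<Longrightarrow> sin_squared_mean x = 1 / k \<Longrightarrow> x = branch_parameter k"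
proof -
  have ex1: "\<exists>!x. x > 0 \<and> sin_squared_mean x = 1 / k"
    using assms by (intro sin_squared_mean_solution) (auto simp: field_simps)
  from theI'[OF this] show *: "branch_parameter k > 0" "sin_squared_mean (branch_parameter k) = 1 / k"
    by (auto simp: branch_parameter_def)
  show "x > 0 \<Longrightarrow> sin_squared_mean x = 1 / k \<Longrightarrow> x = branch_parameter k"
    using ex1 * by blast
qed

text \<open>
  Comparing the parameter at \<open>j\<close> with a bound \<open>b \<ge> 0\<close> amounts to comparing \<open>1 / j\<close> with the
  value at \<open>b\<close> of the strictly decreasing \<^const>\<open>sin_squared_mean\<close>, and \<open>1 / j\<close> depends
  continuously on \<open>j\<close>.
\<close>

lemma isCont_branch_parameter:
  assumes "k > 2"
  shows "isCont branch_parameter k"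
proof -
  let ?x = "branch_parameter k"
  note k = branch_parameter(1,2)[OF assms]
  have lim: "((\<lambda>j. 1 / j) \<longlongrightarrow> sin_squared_mean ?x) (at k)"
    using assms by (auto intro!: tendsto_eq_intros simp: k)
  have ev2: "eventually (\<lambda>j. j > 2) (at k)"
    using assms order_tendstoD(1)[OF tendsto_ident_at] by blast
  have order: "branch_parameter j < b \<longleftrightarrow> sin_squared_mean b < 1 / j" if "j > 2" "b \<ge> 0" for j b
    using sin_squared_mean_strict_antimono[of b "branch_parameter j"]
      sin_squared_mean_strict_antimono[of "branch_parameter j" b] branch_parameter(1,2)[OF that(1)] that(2)
    by (cases b "branch_parameter j" rule: linorder_cases) auto
  have "(branch_parameter \<longlongrightarrow> ?x) (at k)"
  proof (rule order_tendstoI)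
    fix b assume b: "?x < b"
    then have "sin_squared_mean b < sin_squared_mean ?x"
      using k by (intro sin_squared_mean_strict_antimono) auto
    from order_tendstoD(1)[OF lim this] ev2
    show "eventually (\<lambda>j. branch_parameter j < b) (at k)"
      by eventually_elim (use order b k in auto)
  next
    fix b assume b: "b < ?x"
    show "eventually (\<lambda>j. b < branch_parameter j) (at k)"
    proof (cases "b < 0")
      case True
      from ev2 show ?thesis by eventually_elim (use branch_parameter(1) True in force)
    next
      case False
      then have "sin_squared_mean ?x < sin_squared_mean b"
        using b by (intro sin_squared_mean_strict_antimono) auto
      from order_tendstoD(2)[OF lim this] ev2 show ?thesis
      proof eventually_elim
        case (elim j)
        then show ?case
          using sin_squared_mean_strict_antimono[of "branch_parameter j" b]
            branch_parameter(1,2)[of j] False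
          by (cases b "branch_parameter j" rule: linorder_cases) auto
      qed
    qed
  qed
  then show ?thesis by (simp add: isCont_def)
qed

section \<open>Convolution with a density of period a fraction of the circle\<close>

text \<open>
  Translation by the period \<open>h = 2\<pi> / L\<close> of \<open>p\<close> rotates the vector of the \<open>l\<close>-th cosine and sine
  coefficients by the angle \<open>l h\<close>, yet leaves it unchanged. As \<open>0 < l h < 2\<pi>\<close>, the rotation is not the
  identity and its only fixed point is \<open>0\<close>.
\<close>

lemma fourier_coeffs_vanish:
  fixes p :: "real \<Rightarrow> real"
  assumes cont: "continuous_on UNIV p" and per: "\<And>x. p (x + 2 * pi / real L) = p x"
    and l: "1 \<le> l" "l < L"
  shows "circle_integral (\<lambda>y. cos (real l * y) * p y) = 0" "circle_integral (\<lambda>y. sin (real l * y) * p y) = 0"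
proof -
  define h where "h = 2 * pi / real L"
  define \<alpha> where "\<alpha> = real l * h"
  let ?C = "circle_integral (\<lambda>y. cos (real l * y) * p y)" and ?S = "circle_integral (\<lambda>y. sin (real l * y) * p y)"
  have h: "0 \<le> h" "h \<le> 2 * pi" "real L * h = 2 * pi" using l by (auto simp: h_def field_simps)
  have perp: "p (x + 2 * pi) = p x" for x
    using periodic_multiple[of p h x L] per h by (simp add: h_def)
  have perc: "cos (real l * (x + 2 * pi)) = cos (real l * x)"
      "sin (real l * (x + 2 * pi)) = sin (real l * x)" for x
    using cos.plus_of_nat[of "real l * x" l] sin.plus_of_nat[of "real l * x" l]
    by (auto simp: algebra_simps)
  have int: "(\<lambda>y. b * (g (real l * y) * p y)) integrable_on {0..2 * pi}"
    if "g = cos \<or> g = sin" for g :: "real \<Rightarrow> real" and b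
    using that by (intro continuous_integrable_Icc) (auto intro!: continuous_intros cont)
  have C: "?C = cos \<alpha> * ?C - sin \<alpha> * ?S"
  proof -
    have "?C = circle_integral (\<lambda>y. cos (real l * (y + h)) * p (y + h))"
      by (rule periodic_integral_shift[symmetric])
        (auto intro!: continuous_intros cont h simp: perc perp)
    also have "\<dots> = circle_integral (\<lambda>y. cos \<alpha> * (cos (real l * y) * p y) - sin \<alpha> * (sin (real l * y) * p y))"
      by (simp add: per[folded h_def] \<alpha>_def distrib_left cos_add) (simp add: algebra_simps)
    also have "\<dots> = cos \<alpha> * ?C - sin \<alpha> * ?S"
      by (subst Henstock_Kurzweil_Integration.integral_diff) (auto intro!: int)
    finally show ?thesis .
  qed
  have S: "?S = sin \<alpha> * ?C + cos \<alpha> * ?S"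
  proof -
    have "?S = circle_integral (\<lambda>y. sin (real l * (y + h)) * p (y + h))"
      by (rule periodic_integral_shift[symmetric])
        (auto intro!: continuous_intros cont h simp: perc perp)
    also have "\<dots> = circle_integral (\<lambda>y. sin \<alpha> * (cos (real l * y) * p y) + cos \<alpha> * (sin (real l * y) * p y))"
      by (simp add: per[folded h_def] \<alpha>_def distrib_left sin_add) (simp add: algebra_simps)
    also have "\<dots> = sin \<alpha> * ?C + cos \<alpha> * ?S"
      by (subst Henstock_Kurzweil_Integration.integral_add) (auto intro!: int)
    finally show ?thesis .
  qed
  have "0 < \<alpha>" "\<alpha> < 2 * pi" using l by (auto simp: \<alpha>_def h_def field_simps)
  then have "cos \<alpha> \<noteq> 1"
    by (auto simp: cos_one_2pi_int mult_less_cancel_right2 zero_less_mult_iff)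
  have rot: "(1 - cos \<alpha>) * ?C = - (sin \<alpha> * ?S)" "(1 - cos \<alpha>) * ?S = sin \<alpha> * ?C"
    using C S by (auto simp: algebra_simps)
  have "(1 - cos \<alpha>) * (?C\<^sup>2 + ?S\<^sup>2)
      = ((1 - cos \<alpha>) * ?C) * ?C + ((1 - cos \<alpha>) * ?S) * ?S"
    by (simp add: power2_eq_square distrib_left mult.assoc)
  also have "\<dots> = 0" unfolding rot by simp
  finally have "(1 - cos \<alpha>) * (?C\<^sup>2 + ?S\<^sup>2) = 0" .
  then show "?C = 0" "?S = 0" using \<open>cos \<alpha> \<noteq> 1\<close> by (auto simp: sum_power2_eq_zero_iff)
qed

definition kuramoto_density :: "nat \<Rightarrow> real \<Rightarrow> real \<Rightarrow> real" where
  "kuramoto_density L z x = 1 / bessel_I 0 z * exp (z * cos (real L * x))"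

lemma continuous_kuramoto_density: "continuous_on A (kuramoto_density L z)"
  unfolding kuramoto_density_def[abs_def] by (intro continuous_intros)

lemma kuramoto_density_periodic:
  assumes "L \<ge> 1"
  shows "kuramoto_density L z (x + 2 * pi / real L) = kuramoto_density L z x"
  using assms by (simp add: kuramoto_density_def distrib_left)

lemma circle_density_kuramoto:
  assumes "L \<ge> 1"
  shows "circle_density (kuramoto_density L z)"
proof -
  have "kuramoto_density L z (x + 2 * pi) = kuramoto_density L z x" for x
    using periodic_multiple[of "kuramoto_density L z" "2 * pi / real L" x L]
      kuramoto_density_periodic[OF assms] assms by simp
  moreover have "kuramoto_density L z x \<ge> 0" for x
    using bessel_I0_pos[of z] by (simp add: kuramoto_density_def)
  moreover have "circle_integral (kuramoto_density L z) = 2 * pi"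
  proof -
    have "circle_integral (\<lambda>x. exp (z * cos (real L * x))) = circle_integral (\<lambda>x. exp (z * cos x))"
      by (rule periodic_integral_stretch) (use assms in \<open>auto intro!: continuous_intros\<close>)
    then have "circle_integral (\<lambda>x. exp (z * cos (real L * x))) = 2 * pi * bessel_I 0 z"
      by (simp add: bessel_I0_eq)
    then show ?thesis
      using bessel_I0_pos[of z] by (simp add: kuramoto_density_def[abs_def])
  qed
  ultimately show ?thesis
    by (auto simp: circle_density_def circle_function_def
        intro!: continuous_integrable_Icc continuous_kuramoto_density)
qed

text \<open>
  For \<open>l = L\<close> the substitution \<open>y \<mapsto> L y\<close> reduces the coefficient to the one defining \<open>I\<^sub>1\<close>.
\<close>

lemma circle_integral_cos_kuramoto:
  assumes "L \<ge> 1" "1 \<le> l" "l \<le> L"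
  shows "circle_integral (\<lambda>y. cos (real l * y) * kuramoto_density L z y)
      = (if l = L then 2 * pi * (bessel_I 1 z / bessel_I 0 z) else 0)"
proof (cases "l = L")
  case True
  have "circle_integral (\<lambda>y. cos (real L * y) * exp (z * cos (real L * y))) = circle_integral (\<lambda>y. cos y * exp (z * cos y))"
    by (rule periodic_integral_stretch) (use assms in \<open>auto intro!: continuous_intros\<close>)
  then have "circle_integral (\<lambda>y. 1 / bessel_I 0 z * (cos (real L * y) * exp (z * cos (real L * y))))
     = 2 * pi * (bessel_I 1 z / bessel_I 0 z)"
    by (simp add: bessel_I_def[of "Suc 0"] mult.commute)
  then show ?thesis by (simp add: True kuramoto_density_def mult_ac)
next
  case False
  then show ?thesis
    using fourier_coeffs_vanish(1)[OF continuous_kuramoto_density kuramoto_density_periodic] assms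
    by simp
qed

lemma circle_integral_sin_kuramoto:
  assumes "L \<ge> 1"
  shows "circle_integral (\<lambda>y. sin (real l * y) * kuramoto_density L z y) = 0"
proof -
  have per: "kuramoto_density L z (x + 2 * pi) = kuramoto_density L z x" for x
    using circle_density_kuramoto[OF assms, of z] by (simp add: circle_density_def circle_function_def)
  have "sin (real l * (x + 2 * pi)) = sin (real l * x)" for x
    using sin.plus_of_nat[of "real l * x" l] by (simp add: algebra_simps)
  with per have "circle_integral (\<lambda>y. sin (real l * (-y)) * kuramoto_density L z (-y))
      = circle_integral (\<lambda>y. sin (real l * y) * kuramoto_density L z y)"
    by (intro periodic_integral_reflect) simp
  then show ?thesis by (simp add: kuramoto_density_def)
qed

lemma circle_conv_kuramoto:
  assumes L: "L \<ge> 1" and W: "\<And>\<theta>. W \<theta> = (\<Sum>l=1..L. a l * cos (real l * \<theta>))"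
  shows "circle_conv W (kuramoto_density L z) x
      = a L * (bessel_I 1 z / bessel_I 0 z) * cos (real L * x)"
proof -
  let ?p = "kuramoto_density L z"
  have int: "(\<lambda>y. b * (g (real l * y) * ?p y)) integrable_on {0..2 * pi}"
    if "g = cos \<or> g = sin" for g :: "real \<Rightarrow> real" and b l
    using that by (intro continuous_integrable_Icc)
      (auto intro!: continuous_intros continuous_kuramoto_density)
  have W': "W (x - y) * ?p y = (\<Sum>l=1..L. a l * cos (real l * x) * (cos (real l * y) * ?p y)
      + a l * sin (real l * x) * (sin (real l * y) * ?p y))" for y
    by (simp add: W right_diff_distrib cos_diff sum_distrib_right sum_distrib_left distrib_left
        distrib_right mult_ac)
  have "circle_integral (\<lambda>y. W (x - y) * ?p y)
     = (\<Sum>l=1..L. circle_integral (\<lambda>y. a l * cos (real l * x) * (cos (real l * y) * ?p y)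
      + a l * sin (real l * x) * (sin (real l * y) * ?p y)))"
    unfolding W' by (intro integral_sum integrable_add int) auto
  also have "\<dots> = (\<Sum>l=1..L. a l * cos (real l * x) * circle_integral (\<lambda>y. cos (real l * y) * ?p y)
      + a l * sin (real l * x) * circle_integral (\<lambda>y. sin (real l * y) * ?p y))"
    by (intro sum.cong refl, subst Henstock_Kurzweil_Integration.integral_add)
      (auto intro!: int)
  also have "\<dots> = (\<Sum>l=1..L. if l = L then
      a L * cos (real L * x) * (2 * pi * (bessel_I 1 z / bessel_I 0 z)) else 0)"
    using L by (intro sum.cong refl) (auto simp: circle_integral_cos_kuramoto circle_integral_sin_kuramoto)
  also have "\<dots> = a L * cos (real L * x) * (2 * pi * (bessel_I 1 z / bessel_I 0 z))"
    using L by simp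
  finally show ?thesis by (simp add: circle_conv_def)
qed

section \<open>The branch of stationary solutions\<close>

text \<open>
  The equation holds in the stronger, once integrated form \<open>p' = \<kappa> p (W \<star> p)'\<close>: by the condition on
  \<open>z\<close>, the function \<open>\<kappa> (W \<star> p)\<close> is the exponent \<open>z cos (L x)\<close> of \<open>p\<close>.
\<close>

lemma stationary_kuramoto_density:
  assumes L: "L \<ge> 1" and W: "\<And>\<theta>. W \<theta> = (\<Sum>l=1..L. a l * cos (real l * \<theta>))"
    and z: "z = \<kappa> * a L * (bessel_I 1 z / bessel_I 0 z)"
  shows "stationary_McKean_Vlasov W \<kappa> (kuramoto_density L z)"
proof -
  let ?p = "kuramoto_density L z"
  define \<rho> where "\<rho> = bessel_I 1 z / bessel_I 0 z"
  have conv: "circle_conv W ?p = (\<lambda>x. a L * \<rho> * cos (real L * x))"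
    using circle_conv_kuramoto[OF L W] by (auto simp: \<rho>_def)
  have dconv: "(circle_conv W ?p has_real_derivative
      - (a L * \<rho> * real L * sin (real L * x))) (at x)" for x
    unfolding conv by (auto intro!: derivative_eq_intros)
  have dp: "(?p has_real_derivative - (z * real L * sin (real L * x) * ?p x)) (at x)" for x
    using bessel_I0_pos[of z] unfolding kuramoto_density_def[abs_def]
    by (auto intro!: derivative_eq_intros)
  have deriv_p: "deriv ?p = (\<lambda>x. - (z * real L * sin (real L * x) * ?p x))"
    using DERIV_imp_deriv[OF dp] by auto
  have deriv_conv: "deriv (circle_conv W ?p) = (\<lambda>x. - (a L * \<rho> * real L * sin (real L * x)))"
    using DERIV_imp_deriv[OF dconv] by auto
  have diff_p: "?p differentiable at x" for x
    using dp by (auto simp: real_differentiable_def)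
  have diff_sin: "(\<lambda>x. c * sin (real L * x)) differentiable at x" for c x
    by (auto intro!: derivative_eq_intros exI simp: real_differentiable_def)
  have diff_flux: "(\<lambda>y. ?p y * deriv (circle_conv W ?p) y) differentiable at x" for x
    unfolding deriv_conv
    using differentiable_mult[OF diff_p diff_sin[of "- (a L * \<rho> * real L)" x]] by simp
  have flux: "deriv ?p = (\<lambda>y. \<kappa> * (?p y * deriv (circle_conv W ?p) y))"
  proof
    fix x
    have "\<kappa> * (?p x * deriv (circle_conv W ?p) x)
        = - ((\<kappa> * a L * \<rho>) * real L * sin (real L * x) * ?p x)"
      by (simp add: deriv_conv)
    then show "deriv ?p x = \<kappa> * (?p x * deriv (circle_conv W ?p) x)"
      by (simp only: deriv_p z[folded \<rho>_def, symmetric])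
  qed
  show ?thesis
    unfolding stationary_McKean_Vlasov_def
  proof (intro conjI allI)
    show "circle_density ?p" by (rule circle_density_kuramoto[OF L])
    show "?p differentiable at x" for x by (rule diff_p)
    show "deriv ?p differentiable at x" for x
      unfolding flux using differentiable_mult[OF differentiable_const diff_flux] .
    show "circle_conv W ?p differentiable at x" for x
      using dconv by (auto simp: real_differentiable_def)
    show "(\<lambda>y. ?p y * deriv (circle_conv W ?p) y) differentiable at x" for x
      by (rule diff_flux)
    show "deriv (deriv ?p) x = \<kappa> * deriv (\<lambda>y. ?p y * deriv (circle_conv W ?p) y) x" for x
      using diff_flux[of x]
      by (subst flux, intro deriv_cmult) (simp add: field_differentiable_def real_differentiable_def)
  qed
qed

lemma kuramoto_density_nontrivial:
  assumes "L \<ge> 1" "z \<noteq> 0"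
  shows "kuramoto_density L z \<noteq> (\<lambda>_. 1)"
proof
  assume "kuramoto_density L z = (\<lambda>_. 1)"
  then have "kuramoto_density L z 0 = kuramoto_density L z (pi / real L)" by simp
  then show False using assms bessel_I0_pos[of z] by (simp add: kuramoto_density_def)
qed

text \<open>
  The density depends on \<open>x\<close> only through \<open>cos (L x)\<close>, which ranges over a compact interval. Uniform
  continuity of \<open>(v, c) \<mapsto> exp (v c) / I\<^sub>0(v)\<close> on a compact rectangle makes the limit uniform
  in \<open>x\<close>.
\<close>

lemma uniform_limit_kuramoto_density:
  assumes "(z \<longlongrightarrow> w) F"
  shows "uniform_limit UNIV (\<lambda>k. kuramoto_density L (z k)) (kuramoto_density L w) F"
proof (rule uniform_limitI)
  fix e :: real assume "e > 0"
  let ?K = "{w - 1..w + 1} \<times> {-1..1::real}"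
  let ?h = "\<lambda>(v, c). 1 / bessel_I 0 v * exp (v * c)"
  have "continuous_on ?K ?h"
    using bessel_I0_pos less_imp_neq[OF bessel_I0_pos] unfolding case_prod_unfold
    by (intro continuous_intros continuous_on_compose2[OF continuous_bessel_I0]) auto
  then have "uniformly_continuous_on ?K ?h"
    by (rule compact_uniformly_continuous) (intro compact_Times compact_Icc)
  then obtain \<delta> where \<delta>: "\<delta> > 0"
    "\<forall>u\<in>?K. \<forall>v\<in>?K. dist v u < \<delta> \<longrightarrow> dist (?h v) (?h u) < e"
    using \<open>e > 0\<close> unfolding uniformly_continuous_on_def by blast
  have "eventually (\<lambda>k. dist (z k) w < min \<delta> 1) F"
    using assms \<delta> by (intro tendstoD) auto
  then show "eventually (\<lambda>k. \<forall>x\<in>UNIV. dist (kuramoto_density L (z k) x) (kuramoto_density L w x) < e) F"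
  proof eventually_elim
    case (elim k)
    show ?case
    proof
      fix x
      have "dist (?h (z k, cos (real L * x))) (?h (w, cos (real L * x))) < e"
        using elim by (intro \<delta>(2)[rule_format]) (auto simp: dist_Pair_Pair dist_real_def)
      then show "dist (kuramoto_density L (z k) x) (kuramoto_density L w x) < e"
        by (simp add: kuramoto_density_def)
    qed
  qed
qed

theorem theorem3p2:
  fixes L :: nat and a :: "nat \<Rightarrow> real" and W :: "real \<Rightarrow> real"
  assumes "L \<ge> 1"
    and "\<And>i j. 1 \<le> i \<Longrightarrow> i < j \<Longrightarrow> j \<le> L \<Longrightarrow> a i > a j"
    and "a L > 0"
    and "\<And>\<theta>. W \<theta> = (\<Sum>l=1..L. a l * cos (real l * \<theta>))"
  shows "\<exists>r :: real \<Rightarrow> real.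
    (\<forall>\<kappa> > 2 / a L.
       (0 < r \<kappa> \<and> r \<kappa> = bessel_I 1 (\<kappa> * a L * r \<kappa>) / bessel_I 0 (\<kappa> * a L * r \<kappa>)) \<and>
       (\<forall>s. 0 < s \<and> s = bessel_I 1 (\<kappa> * a L * s) / bessel_I 0 (\<kappa> * a L * s) \<longrightarrow> s = r \<kappa>)) \<and>
    global_nontrivial_branch W (2 / a L)
      (\<lambda>\<kappa> \<theta>. 1 / bessel_I 0 (\<kappa> * a L * r \<kappa>) * exp (\<kappa> * a L * r \<kappa> * cos (real L * \<theta>)))"
proof -
  define z where "z \<kappa> = branch_parameter (\<kappa> * a L)" for \<kappa>
  define r where "r \<kappa> = z \<kappa> / (\<kappa> * a L)" for \<kappa>
  have k2: "\<kappa> * a L > 2" if "\<kappa> > 2 / a L" for \<kappa>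
    using that \<open>a L > 0\<close> by (simp add: field_simps)
  have kne: "\<kappa> * a L \<noteq> 0" if "\<kappa> > 2 / a L" for \<kappa>
    using k2[OF that] by linarith
  have zr: "\<kappa> * a L * r \<kappa> = z \<kappa>" if "\<kappa> > 2 / a L" for \<kappa>
    using kne[OF that] by (simp add: r_def)
  have zpos: "z \<kappa> > 0" if "\<kappa> > 2 / a L" for \<kappa>
    using branch_parameter(1)[OF k2[OF that]] by (simp add: z_def)
  have r_eq: "r \<kappa> = bessel_I 1 (z \<kappa>) / bessel_I 0 (z \<kappa>)" if "\<kappa> > 2 / a L" for \<kappa>
    unfolding bessel_ratio_eq r_def z_def branch_parameter(2)[OF k2[OF that]] by simp
  \<comment> \<open>Dividing \<open>s = z S(z)\<close>, where \<open>z = \<kappa> a\<^sub>L s\<close>, by \<open>s\<close> leaves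
    \<open>S(z) = 1 / (\<kappa> a\<^sub>L)\<close>, which determines \<open>z\<close>.\<close>
  have r_unique: "s = r \<kappa>"
    if \<kappa>: "\<kappa> > 2 / a L" and s: "0 < s" "s = bessel_I 1 (\<kappa> * a L * s) / bessel_I 0 (\<kappa> * a L * s)" for \<kappa> s
  proof -
    have "s = \<kappa> * a L * s * sin_squared_mean (\<kappa> * a L * s)"
      using s(2) by (simp only: bessel_ratio_eq)
    then have "s * (\<kappa> * a L * sin_squared_mean (\<kappa> * a L * s)) = s * 1"
      by (simp only: mult_ac mult_1_right)
    then have "\<kappa> * a L * sin_squared_mean (\<kappa> * a L * s) = 1"
      using s(1) by (simp only: mult_left_cancel)
    then have "sin_squared_mean (\<kappa> * a L * s) = 1 / (\<kappa> * a L)"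
      using kne[OF \<kappa>] by (intro nonzero_eq_divide_eq[THEN iffD2]) (auto simp: mult_ac)
    then have "\<kappa> * a L * s = z \<kappa>"
      unfolding z_def using k2[OF \<kappa>] s(1)
      by (intro branch_parameter(3) mult_pos_pos[where b = s]) auto
    then have "r \<kappa> = \<kappa> * a L * s / (\<kappa> * a L)" by (simp only: r_def)
    then show ?thesis using kne[OF \<kappa>] by simp
  qed
  let ?p = "\<lambda>\<kappa> \<theta>. 1 / bessel_I 0 (\<kappa> * a L * r \<kappa>) * exp (\<kappa> * a L * r \<kappa> * cos (real L * \<theta>))"
  have p: "?p \<kappa> = kuramoto_density L (z \<kappa>)" if "\<kappa> > 2 / a L" for \<kappa>
    by (simp add: zr[OF that] kuramoto_density_def[abs_def])
  have "stationary_McKean_Vlasov W \<kappa> (?p \<kappa>) \<and> ?p \<kappa> \<noteq> (\<lambda>_. 1)" if \<kappa>: "\<kappa> > 2 / a L" for \<kappa>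
    unfolding p[OF \<kappa>]
  proof
    have "z \<kappa> = \<kappa> * a L * (bessel_I 1 (z \<kappa>) / bessel_I 0 (z \<kappa>))"
      using zr[OF \<kappa>] r_eq[OF \<kappa>] by simp
    then show "stationary_McKean_Vlasov W \<kappa> (kuramoto_density L (z \<kappa>))"
      by (rule stationary_kuramoto_density[OF assms(1,4)])
    show "kuramoto_density L (z \<kappa>) \<noteq> (\<lambda>_. 1)"
      using zpos[OF \<kappa>] by (intro kuramoto_density_nontrivial[OF assms(1)]) simp
  qed
  moreover have "uniform_limit UNIV ?p (?p \<kappa>) (at \<kappa>)" if \<kappa>: "\<kappa> > 2 / a L" for \<kappa>
  proof -
    have "isCont (\<lambda>\<kappa>. \<kappa> * a L) \<kappa>" by (intro continuous_intros)
    from isCont_o2[OF this isCont_branch_parameter[OF k2[OF \<kappa>]]] have "isCont z \<kappa>"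
      by (simp only: z_def[abs_def])
    then have lim: "uniform_limit UNIV (\<lambda>k. kuramoto_density L (z k)) (kuramoto_density L (z \<kappa>)) (at \<kappa>)"
      by (intro uniform_limit_kuramoto_density) (simp only: isCont_def)
    have "eventually (\<lambda>k. k > 2 / a L) (at \<kappa>)"
      using \<kappa> order_tendstoD(1)[OF tendsto_ident_at] by blast
    then have "eventually (\<lambda>k. \<forall>x\<in>UNIV. kuramoto_density L (z k) x = ?p k x) (at \<kappa>)"
      by eventually_elim (rule ballI, rule fun_cong[OF p, symmetric])
    then have "uniform_limit UNIV (\<lambda>k. kuramoto_density L (z k)) (kuramoto_density L (z \<kappa>)) (at \<kappa>)
        \<longleftrightarrow> uniform_limit UNIV ?p (kuramoto_density L (z \<kappa>)) (at \<kappa>)"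
      by (rule uniform_limit_cong) (rule refl)
    with lim show ?thesis unfolding p[OF \<kappa>] by (rule iffD1[rotated])
  qed
  ultimately have "global_nontrivial_branch W (2 / a L) ?p"
    unfolding global_nontrivial_branch_def by blast
  moreover have "0 < r \<kappa> \<and> r \<kappa> = bessel_I 1 (\<kappa> * a L * r \<kappa>) / bessel_I 0 (\<kappa> * a L * r \<kappa>)"
    if \<kappa>: "\<kappa> > 2 / a L" for \<kappa>
    using divide_pos_pos[OF zpos[OF \<kappa>], of "\<kappa> * a L"] k2[OF \<kappa>] r_eq[OF \<kappa>] zr[OF \<kappa>]
    by (simp add: r_def[symmetric])
  ultimately show ?thesis
    using r_unique by (intro exI[of _ r]) blast
qed

end
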